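(* Let $\mathbb F$ be a field, let $H=([n],E)$ be a hypergraph with edges $E=\{e_1,\ldots,e_m\}$ (multiple edges allowed, every edge a subset of $[n]$ of size at least $2$), and let $$p(x_1,\ldots,x_n)=\prod_{e\in E}\Big(\sum_{i\in e}a_{e,i}x_i\Big)\in\mathbb F[x_1,\ldots,x_n],\qquad a_{e,i}\in\mathbb F\setminus\{0\},$$ be a fully unbalanced hypergraph polynomial of $H$. Then there exist permutations $\sigma_{e_1}\in S_{e_1},\ldots,\sigma_{e_m}\in S_{e_m}$ such that $$AT(p_{\sigma_{e_1}\sigma_{e_2}\ldots\sigma_{e_m}})\le 2\lceil \mathrm{ed}(H)\rceil+1.$$
   Context: A hypergraph polynomial of $H$ over $\mathbb F$ is any polynomial of the displayed form with all $a_{e,i}\neq 0$. It is fully unbalanced if for every edge $e$ there are $i,j\in e$ with $a_{e,i}\neq a_{e,j}$. For permutations $\sigma_{e}\in S_{e}$ of the vertex sets of the edges, the permuted polynomial is $p_{\sigma_{e_1}\ldots\sigma_{e_m}}(x_1,\ldots,x_n)=\prod_{i\in[m]}\big(\sum_{v\in e_i}a_{e_i,\sigma_{e_i}(v)}x_v\big)$ (coefficients are permuted within each factor, variables are not). For a polynomial $p=\sum_\alpha c_\alpha x_1^{\alpha_1}\cdots x_n^{\alpha_n}$, let $S(p)=\{\alpha:\sum_i\alpha_i=\deg p,\ c_\alpha\neq0\}$; the Alon--Tarsi number is $AT(p)=\min_{\alpha\in S(p)}\max\{\alpha_1,\ldots,\alpha_n\}+1$. The edge density is $\mathrm{ed}(H)=\max_{\emptyset\neq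 X\subseteq V}|E(X)|/|X|$, where $E(X)=\{e\in E: e\subseteq X\}$ (counted with multiplicity). *)

theory Defs
  imports Complex_Main "HOL-Library.Poly_Mapping" "HOL-Combinatorics.Permutations"
begin

text \<open>
  Polynomials in the variables \<open>x\<^sub>1, x\<^sub>2, \<dots>\<close> are finitely supported maps from
  exponent vectors to coefficients; multiplication is the convolution product of
  \<^theory>\<open>HOL-Library.Poly_Mapping\<close>.
\<close>

type_synonym exponent = "nat \<Rightarrow>\<^sub>0 nat"
type_synonym 'a mpoly = "exponent \<Rightarrow>\<^sub>0 'a"

text \<open>The term \<open>c x\<^sub>v\<close>.\<close>

definition linear_term :: "'a::zero \<Rightarrow> nat \<Rightarrow> 'a mpoly" where
  "linear_term c v = Poly_Mapping.single (Poly_Mapping.single v 1) c"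

definition exponent_sum :: "exponent \<Rightarrow> nat" where
  "exponent_sum \<alpha> = (\<Sum>i\<in>Poly_Mapping.keys \<alpha>. Poly_Mapping.lookup \<alpha> i)"

text \<open>The inserted \<open>0\<close> only matters for the zero polynomial.\<close>

definition total_degree :: "'a::zero mpoly \<Rightarrow> nat" where
  "total_degree p = Max (insert 0 (exponent_sum ` Poly_Mapping.keys p))"

definition leading_exponents :: "'a::zero mpoly \<Rightarrow> exponent set" where
  "leading_exponents p =
     {\<alpha>. exponent_sum \<alpha> = total_degree p \<and> Poly_Mapping.lookup p \<alpha> \<noteq> 0}"

text \<open>
  The argument \<open>n\<close> is the number of variables. The value is meaningful for \<open>n \<ge> 1\<close> and
  nonzero \<open>p\<close> in the variables \<open>x\<^sub>1, \<dots>, x\<^sub>n\<close>.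
\<close>

definition alon_tarsi_number :: "nat \<Rightarrow> 'a::zero mpoly \<Rightarrow> nat" where
  "alon_tarsi_number n p =
     Min ((\<lambda>\<alpha>. Max (Poly_Mapping.lookup \<alpha> ` {1..n})) ` leading_exponents p) + 1"

text \<open>
  A hypergraph on the vertex set \<open>{1..n}\<close> is given by the family of its edges \<open>e 1, \<dots>, e m\<close>,
  which need not be distinct.
\<close>

definition hypergraph :: "nat \<Rightarrow> nat \<Rightarrow> (nat \<Rightarrow> nat set) \<Rightarrow> bool" where
  "hypergraph n m e \<longleftrightarrow> (\<forall>k\<in>{1..m}. e k \<subseteq> {1..n} \<and> 2 \<le> card (e k))"

definition edge_density :: "nat \<Rightarrow> nat \<Rightarrow> (nat \<Rightarrow> nat set) \<Rightarrow> real" where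
  "edge_density n m e =
     Max ((\<lambda>X. real (card {k\<in>{1..m}. e k \<subseteq> X}) / real (card X)) ` {X. X \<noteq> {} \<and> X \<subseteq> {1..n}})"

definition hypergraph_polynomial ::
    "nat \<Rightarrow> (nat \<Rightarrow> nat set) \<Rightarrow> (nat \<Rightarrow> nat \<Rightarrow> 'a::comm_ring_1) \<Rightarrow> 'a mpoly" where
  "hypergraph_polynomial m e a = (\<Prod>k\<in>{1..m}. \<Sum>v\<in>e k. linear_term (a k v) v)"

definition permuted_polynomial ::
    "nat \<Rightarrow> (nat \<Rightarrow> nat set) \<Rightarrow> (nat \<Rightarrow> nat \<Rightarrow> 'a::comm_ring_1) \<Rightarrow> (nat \<Rightarrow> nat \<Rightarrow> nat) \<Rightarrow> 'a mpoly"
  where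
  "permuted_polynomial m e a \<sigma> = hypergraph_polynomial m e (\<lambda>k v. a k (\<sigma> k v))"

definition fully_unbalanced ::
    "nat \<Rightarrow> (nat \<Rightarrow> nat set) \<Rightarrow> (nat \<Rightarrow> nat \<Rightarrow> 'a) \<Rightarrow> bool" where
  "fully_unbalanced m e a \<longleftrightarrow> (\<forall>k\<in>{1..m}. \<exists>i\<in>e k. \<exists>j\<in>e k. a k i \<noteq> a k j)"

end

theory Submission
  imports Defs
begin

text \<open>
  Let \<open>d = \<lceil>ed(H)\<rceil>\<close>. Every edge can be shrunk to a pair of its vertices without destroying
  \<open>|E(X)| \<le> d |X|\<close>: two tight sets \<open>X\<close>, \<open>Y\<close> that forbid the removal of two different vertices of
  the same edge would contradict the condition for \<open>X \<union> Y\<close>. The resulting multigraph is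
  \<open>2d\<close>-degenerate, so its vertices can be ranked such that at most \<open>2d\<close> edges have their top
  vertex at any given place. In the product of the forms \<open>x\<^sub>u - x\<^sub>v\<close> over the edges of the
  multigraph, the monomial that collects the top vertices arises in only one way.
  Since the edge \<open>k\<close> is unbalanced, a nonzero multiple of \<open>x\<^sub>u - x\<^sub>v\<close> is the difference of two
  permuted forms of this edge, so by multilinearity the same monomial survives for a suitable
  choice of permutations.
\<close>

section \<open>Sparse hypergraphs\<close>

text \<open>Counting the edges inside a set is supermodular. The gain of 1 is the edge
  \<open>k\<close>, which is counted for the union but for neither of the two sets.\<close>

lemma card_edges_union:
  fixes g :: "'i \<Rightarrow> 'v set"
  assumes "finite K" "k \<in> K" "g k \<subseteq> X \<union> Y" "\<not> g k \<subseteq> X" "\<not> g k \<subseteq> Y"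
  shows "card {l\<in>K. g l \<subseteq> X} + card {l\<in>K. g l \<subseteq> Y} + 1
         \<le> card {l\<in>K. g l \<subseteq> X \<union> Y} + card {l\<in>K. g l \<subseteq> X \<inter> Y}"
proof -
  let ?E = "\<lambda>Z. {l\<in>K. g l \<subseteq> Z}"
  have "card (?E X) + card (?E Y) = card (?E X \<union> ?E Y) + card (?E X \<inter> ?E Y)"
    using assms(1) by (intro card_Un_Int) auto
  moreover have "?E X \<inter> ?E Y = ?E (X \<inter> Y)"
    by auto
  moreover have "card (insert k (?E X \<union> ?E Y)) \<le> card (?E (X \<union> Y))"
    using assms by (intro card_mono) auto
  moreover have "card (insert k (?E X \<union> ?E Y)) = card (?E X \<union> ?E Y) + 1"
    using assms by (subst card_insert_disjoint) auto
  ultimately show ?thesis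
    by simp
qed

text \<open>Shrinking the single edge \<open>k\<close> raises a count by at most one. A set whose
  bound breaks was therefore tight before, and \<open>k\<close> is the edge that newly fits into
  it.\<close>

lemma tight_set_of_blocked_removal:
  fixes g :: "'i \<Rightarrow> 'v set"
  assumes "finite K" "k \<in> K"
    and sparse: "\<And>X. finite X \<Longrightarrow> card {l\<in>K. g l \<subseteq> X} \<le> d * card X"
    and blocked: "finite X" "\<not> card {l\<in>K. (g(k := g k - {u})) l \<subseteq> X} \<le> d * card X"
  shows "card {l\<in>K. g l \<subseteq> X} = d * card X" "g k - {u} \<subseteq> X" "\<not> g k \<subseteq> X"
proof -
  let ?E = "{l\<in>K. g l \<subseteq> X}" and ?E' = "{l\<in>K. (g(k := g k - {u})) l \<subseteq> X}"
  have less: "card ?E < card ?E'"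
    using sparse[OF blocked(1)] blocked(2) by simp
  have sub: "?E' \<subseteq> insert k ?E"
    by (auto split: if_splits)
  have "\<not> ?E' \<subseteq> ?E"
  proof
    assume "?E' \<subseteq> ?E"
    then have "card ?E' \<le> card ?E"
      using assms(1) by (intro card_mono) auto
    with less show False
      by simp
  qed
  then show "\<not> g k \<subseteq> X" "g k - {u} \<subseteq> X"
    by (auto split: if_splits)
  have "card ?E' \<le> card (insert k ?E)"
    using sub assms(1) by (intro card_mono) auto
  also have "\<dots> \<le> card ?E + 1"
    using card_insert_le_m1[of "card ?E + 1" ?E k] by simp
  finally show "card ?E = d * card X"
    using sparse[OF blocked(1)] blocked(2) by simp
qed

lemma sparse_remove_vertex:
  fixes g :: "'i \<Rightarrow> 'v set"
  assumes "finite K" "k \<in> K"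
    and sparse: "\<And>X. finite X \<Longrightarrow> card {l\<in>K. g l \<subseteq> X} \<le> d * card X"
    and uv: "u \<in> g k" "v \<in> g k" "u \<noteq> v"
  shows "(\<forall>X. finite X \<longrightarrow> card {l\<in>K. (g(k := g k - {u})) l \<subseteq> X} \<le> d * card X) \<or>
         (\<forall>X. finite X \<longrightarrow> card {l\<in>K. (g(k := g k - {v})) l \<subseteq> X} \<le> d * card X)"
proof (rule ccontr)
  assume "\<not> ?thesis"
  then obtain X Y where X: "finite X" "\<not> card {l\<in>K. (g(k := g k - {u})) l \<subseteq> X} \<le> d * card X"
    and Y: "finite Y" "\<not> card {l\<in>K. (g(k := g k - {v})) l \<subseteq> Y} \<le> d * card Y"
    by blast
  have tX: "card {l\<in>K. g l \<subseteq> X} = d * card X" "g k - {u} \<subseteq> X" "\<not> g k \<subseteq> X"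
    using tight_set_of_blocked_removal[OF assms(1,2) _ X] sparse by blast+
  have tY: "card {l\<in>K. g l \<subseteq> Y} = d * card Y" "g k - {v} \<subseteq> Y" "\<not> g k \<subseteq> Y"
    using tight_set_of_blocked_removal[OF assms(1,2) _ Y] sparse by blast+
  \<comment> \<open>Only \<open>u\<close> can be missing from \<open>X\<close>, and since
    \<open>u \<noteq> v\<close> it lies in \<open>g k - {v}\<close>, hence in
    \<open>Y\<close>.\<close>
  have "g k \<subseteq> X \<union> Y"
    using tX(2) tY(2) uv by blast
  from card_edges_union[of K k g X Y, OF assms(1,2) this tX(3) tY(3)]
  have "d * card X + d * card Y + 1 \<le> card {l\<in>K. g l \<subseteq> X \<union> Y} + card {l\<in>K. g l \<subseteq> X \<inter> Y}"
    using tX(1) tY(1) by simp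
  also have "\<dots> \<le> d * card (X \<union> Y) + d * card (X \<inter> Y)"
    using X(1) Y(1) by (intro add_mono sparse) auto
  \<comment> \<open>Cardinality is modular, so the right-hand side gains nothing to match the extra
    edge on the left.\<close>
  also have "\<dots> = d * card X + d * card Y"
    using card_Un_Int[OF X(1) Y(1)] by (simp flip: distrib_left)
  finally show False
    by simp
qed

text \<open>Induction on the total size of the edges: as long as some edge has three or more
  vertices, one of any two of them can be removed.\<close>

lemma sparse_shrink_to_pairs:
  fixes g :: "'i \<Rightarrow> 'v set"
  assumes "finite K" "\<And>k. k \<in> K \<Longrightarrow> finite (g k) \<and> 2 \<le> card (g k)"
    and "\<And>X. finite X \<Longrightarrow> card {l\<in>K. g l \<subseteq> X} \<le> d * card X"
  shows "\<exists>h. (\<forall>k\<in>K. h k \<subseteq> g k \<and> card (h k) = 2) \<and>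
             (\<forall>X. finite X \<longrightarrow> card {l\<in>K. h l \<subseteq> X} \<le> d * card X)"
  using assms(2,3)
proof (induction "\<Sum>k\<in>K. card (g k)" arbitrary: g rule: less_induct)
  case less
  show ?case
  proof (cases "\<forall>k\<in>K. card (g k) = 2")
    case True
    then show ?thesis
      using less.prems(2) by blast
  next
    case False
    then obtain k where k: "k \<in> K" "3 \<le> card (g k)"
      using less.prems(1) by (metis One_nat_def Suc_1 Suc_leI le_neq_implies_less numeral_3_eq_3)
    have "\<not> card (g k) \<le> Suc 0"
      using k by simp
    then obtain u v where uv: "u \<in> g k" "v \<in> g k" "u \<noteq> v"
      using less.prems(1)[OF k(1)] by (auto simp: card_le_Suc0_iff_eq)
    from sparse_remove_vertex[OF assms(1) k(1) less.prems(2) uv] uv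
    obtain w where w: "w \<in> g k"
      and sparse: "\<And>X. finite X \<Longrightarrow> card {l\<in>K. (g(k := g k - {w})) l \<subseteq> X} \<le> d * card X"
      by blast
    let ?g = "g(k := g k - {w})"
    have card: "card (?g k) < card (g k)" "2 \<le> card (?g k)"
      using w k less.prems(1)[OF k(1)] by (auto simp: card_gt_0_iff)
    have "(\<Sum>l\<in>K. card (?g l)) < (\<Sum>l\<in>K. card (g l))"
      using card k(1) assms(1) by (intro sum_strict_mono_ex1) auto
    moreover have "finite (?g l) \<and> 2 \<le> card (?g l)" if "l \<in> K" for l
      using less.prems(1)[OF that] card by auto
    ultimately obtain h where h: "\<forall>l\<in>K. h l \<subseteq> ?g l \<and> card (h l) = 2"
      "\<forall>X. finite X \<longrightarrow> card {l\<in>K. h l \<subseteq> X} \<le> d * card X"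
      using less.hyps[OF _ _ sparse] by blast
    moreover have "?g l \<subseteq> g l" for l
      by auto
    ultimately show ?thesis
      by (meson subset_trans)
  qed
qed

section \<open>Degeneracy of sparse multigraphs\<close>

text \<open>Double counting: the degrees within \<open>X\<close> sum to twice the number of edges
  inside \<open>X\<close>, so their average is at most \<open>2 * d\<close>.\<close>

lemma sparse_low_degree_vertex:
  fixes h :: "'i \<Rightarrow> 'v set"
  assumes "finite K" "\<And>k. k \<in> K \<Longrightarrow> card (h k) = 2"
    and "finite X" "X \<noteq> {}" "card {k\<in>K. h k \<subseteq> X} \<le> d * card X"
  shows "\<exists>v\<in>X. card {k\<in>K. v \<in> h k \<and> h k \<subseteq> X} \<le> 2 * d"
proof (rule ccontr)
  let ?E = "{k\<in>K. h k \<subseteq> X}"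
  assume "\<not> ?thesis"
  then have "(\<Sum>v\<in>X. 2 * d) < (\<Sum>v\<in>X. card {k\<in>K. v \<in> h k \<and> h k \<subseteq> X})"
    using assms(3,4) by (intro sum_strict_mono) auto
  also have "\<dots> = (\<Sum>v\<in>X. card {k\<in>?E. v \<in> h k})"
    by (intro sum.cong arg_cong[where f = card]) auto
  also have "\<dots> = (\<Sum>k\<in>?E. card {v\<in>X. v \<in> h k})"
    using assms(1,3) by (intro sum_multicount_gen[symmetric]) auto
  also have "\<dots> = (\<Sum>k\<in>?E. 2)"
  proof (intro sum.cong refl)
    fix k assume "k \<in> ?E"
    then have "{v\<in>X. v \<in> h k} = h k" "k \<in> K"
      by auto
    then show "card {v\<in>X. v \<in> h k} = 2"
      using assms(2) by simp
  qed
  finally show False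
    using assms(5) by (simp add: mult.commute)
qed

text \<open>A vertex of low degree is peeled off and ranked above all the others, which are ranked
  recursively. The condition \<open>h k \<subseteq> X\<close> keeps to the edges that survive the
  earlier peelings.\<close>

lemma sparse_degenerate_ranking:
  fixes h :: "'i \<Rightarrow> 'v set"
  assumes "finite K" "\<And>k. k \<in> K \<Longrightarrow> card (h k) = 2"
    and sparse: "\<And>X. finite X \<Longrightarrow> card {k\<in>K. h k \<subseteq> X} \<le> d * card X"
    and "finite X"
  shows "\<exists>r :: 'v \<Rightarrow> nat. inj_on r X \<and>
           (\<forall>v\<in>X. card {k\<in>K. v \<in> h k \<and> h k \<subseteq> X \<and> (\<forall>w\<in>h k. r w \<le> r v)} \<le> 2 * d)"
  using \<open>finite X\<close>
proof (induction "card X" arbitrary: X)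
  case 0
  then show ?case
    by auto
next
  case (Suc N)
  then have "X \<noteq> {}"
    by auto
  then obtain v where v: "v \<in> X" "card {k\<in>K. v \<in> h k \<and> h k \<subseteq> X} \<le> 2 * d"
    using sparse_low_degree_vertex[OF assms(1,2) Suc.prems _ sparse[OF Suc.prems]] by blast
  have "N = card (X - {v})" "finite (X - {v})"
    using Suc v(1) by auto
  from Suc.hyps(1)[OF this] obtain r :: "'v \<Rightarrow> nat" where r: "inj_on r (X - {v})"
    "\<And>w. w \<in> X - {v} \<Longrightarrow>
      card {k\<in>K. w \<in> h k \<and> h k \<subseteq> X - {v} \<and> (\<forall>x\<in>h k. r x \<le> r w)} \<le> 2 * d"
    by blast
  let ?r = "r(v := Suc (Max (r ` X)))"
  have top: "?r w < ?r v" if "w \<in> X - {v}" for w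
    using that Suc.prems by (auto simp: less_Suc_eq_le)
  have "inj_on ?r (X - {v})"
    using r(1) by (auto simp: inj_on_def)
  then have "inj_on ?r (insert v (X - {v}))"
    using top by (fastforce simp: inj_on_insert)
  then have "inj_on ?r X"
    using v(1) by (simp add: insert_absorb)
  moreover have "card {k\<in>K. w \<in> h k \<and> h k \<subseteq> X \<and> (\<forall>x\<in>h k. ?r x \<le> ?r w)} \<le> 2 * d"
    if w: "w \<in> X" for w
  proof (cases "w = v")
    case True
    have "card {k\<in>K. w \<in> h k \<and> h k \<subseteq> X \<and> (\<forall>x\<in>h k. ?r x \<le> ?r w)}
          \<le> card {k\<in>K. v \<in> h k \<and> h k \<subseteq> X}"
      using True assms(1) by (intro card_mono) auto
    then show ?thesis
      using v(2) by simp
  next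
    case False
    \<comment> \<open>An edge through \<open>v\<close> has its top at \<open>v\<close>. Edges with
      top \<open>w\<close> thus avoid \<open>v\<close> and are already bounded by the ranking of
      \<open>X - {v}\<close>.\<close>
    have "v \<notin> h k" if "\<forall>x\<in>h k. ?r x \<le> ?r w" for k
      using top[of w] w False that by force
    then have "{k\<in>K. w \<in> h k \<and> h k \<subseteq> X \<and> (\<forall>x\<in>h k. ?r x \<le> ?r w)}
          \<subseteq> {k\<in>K. w \<in> h k \<and> h k \<subseteq> X - {v} \<and> (\<forall>x\<in>h k. r x \<le> r w)}"
      using False by (smt (verit) Collect_mono Diff_empty fun_upd_apply subset_Diff_insert)
    then have "card {k\<in>K. w \<in> h k \<and> h k \<subseteq> X \<and> (\<forall>x\<in>h k. ?r x \<le> ?r w)}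
          \<le> card {k\<in>K. w \<in> h k \<and> h k \<subseteq> X - {v} \<and> (\<forall>x\<in>h k. r x \<le> r w)}"
      using assms(1) by (intro card_mono) auto
    then show ?thesis
      using r(2)[of w] w False by simp
  qed
  ultimately show ?case
    by blast
qed

section \<open>Products of linear forms\<close>

lemma linear_term_diff: "linear_term (b - c) v = linear_term b v - linear_term (c :: 'a::ab_group_add) v"
  by (simp add: linear_term_def single_diff)

lemma prod_single:
  fixes \<alpha> :: "'i \<Rightarrow> 'b::comm_monoid_add" and c :: "'i \<Rightarrow> 'a::comm_semiring_1"
  shows "(\<Prod>k\<in>K. Poly_Mapping.single (\<alpha> k) (c k))
         = Poly_Mapping.single (\<Sum>k\<in>K. \<alpha> k) (\<Prod>k\<in>K. c k)"
  by (induction K rule: infinite_finite_induct) (auto simp: mult_single)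

text \<open>Full expansion of the product: a choice function \<open>f\<close> picks one variable
  from each factor, and the choices whose variables multiply to the monomial \<alpha>
  contribute.\<close>

lemma lookup_prod_linear_forms:
  fixes c :: "'i \<Rightarrow> nat \<Rightarrow> 'a::comm_semiring_1"
  assumes "finite K" "\<And>k. k \<in> K \<Longrightarrow> finite (g k)"
  shows "Poly_Mapping.lookup (\<Prod>k\<in>K. \<Sum>v\<in>g k. linear_term (c k v) v) \<alpha>
         = (\<Sum>f\<in>PiE K g. (\<Prod>k\<in>K. c k (f k)) when (\<Sum>k\<in>K. Poly_Mapping.single (f k) 1) = \<alpha>)"
  using assms
  by (simp add: linear_term_def prod_sum_PiE prod_single lookup_sum lookup_single)

section \<open>Weights of monomials\<close>

lemma lookup_sum_single_one:
  assumes "finite K"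
  shows "Poly_Mapping.lookup (\<Sum>k\<in>K. Poly_Mapping.single (f k) (1::nat)) v = card {k\<in>K. f k = v}"
  using assms by (simp add: lookup_sum lookup_single when_def sum.If_cases Int_def)

text \<open>The left side depends on the monomial alone, so two choices that yield the same monomial
  have the same total rank. Constant rank 1 gives the degree.\<close>

lemma sum_rank_of_exponent:
  fixes r :: "nat \<Rightarrow> nat"
  assumes "finite K"
  shows "(\<Sum>v\<in>Poly_Mapping.keys (\<Sum>k\<in>K. Poly_Mapping.single (f k) (1::nat)).
           Poly_Mapping.lookup (\<Sum>k\<in>K. Poly_Mapping.single (f k) 1) v * r v) = (\<Sum>k\<in>K. r (f k))"
proof -
  let ?\<alpha> = "\<Sum>k\<in>K. Poly_Mapping.single (f k) (1::nat)"
  have keys: "Poly_Mapping.keys ?\<alpha> = f ` K"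
  proof (intro set_eqI)
    fix v
    have "v \<in> Poly_Mapping.keys ?\<alpha> \<longleftrightarrow> card {k\<in>K. f k = v} \<noteq> 0"
      by (simp only: in_keys_iff lookup_sum_single_one[OF assms])
    also have "\<dots> \<longleftrightarrow> v \<in> f ` K"
      using assms by auto
    finally show "v \<in> Poly_Mapping.keys ?\<alpha> \<longleftrightarrow> v \<in> f ` K" .
  qed
  have "(\<Sum>v\<in>f ` K. Poly_Mapping.lookup ?\<alpha> v * r v) = (\<Sum>v\<in>f ` K. \<Sum>k | k \<in> K \<and> f k = v. r (f k))"
    by (simp only: lookup_sum_single_one[OF assms]) simp
  also have "\<dots> = (\<Sum>k\<in>K. r (f k))"
    using assms by (rule sum.image_gen[symmetric])
  finally show ?thesis
    by (simp only: keys)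
qed

lemma exponent_sum_sum_single_one:
  assumes "finite K"
  shows "exponent_sum (\<Sum>k\<in>K. Poly_Mapping.single (f k) 1) = card K"
  using sum_rank_of_exponent[OF assms, of f "\<lambda>_. 1"] by (simp add: exponent_sum_def)

text \<open>Choosing the top vertex everywhere gives a strictly larger total rank than any other
  choice, so no other choice yields this monomial and nothing can cancel.\<close>

lemma lookup_prod_linear_forms_top:
  fixes c :: "'i \<Rightarrow> nat \<Rightarrow> 'a::comm_semiring_1" and r :: "nat \<Rightarrow> nat"
  assumes "finite K" "\<And>k. k \<in> K \<Longrightarrow> finite (g k)"
    and t: "\<And>k. k \<in> K \<Longrightarrow> t k \<in> g k" "\<And>k v. k \<in> K \<Longrightarrow> v \<in> g k \<Longrightarrow> v \<noteq> t k \<Longrightarrow> r v < r (t k)"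
  shows "Poly_Mapping.lookup (\<Prod>k\<in>K. \<Sum>v\<in>g k. linear_term (c k v) v)
           (\<Sum>k\<in>K. Poly_Mapping.single (t k) 1) = (\<Prod>k\<in>K. c k (t k))"
proof -
  \<comment> \<open>Elements of \<open>PiE\<close> are \<open>undefined\<close> outside
    \<open>K\<close>, so \<open>t\<close> has to be restricted to become one of them.\<close>
  let ?t = "restrict t K"
  have unique: "f = ?t" if f: "f \<in> PiE K g"
    and eq: "(\<Sum>k\<in>K. Poly_Mapping.single (f k) (1::nat)) = (\<Sum>k\<in>K. Poly_Mapping.single (t k) 1)" for f
  proof (rule ccontr)
    assume "f \<noteq> ?t"
    then obtain k where k: "k \<in> K" "f k \<noteq> t k"
      using f by (metis PiE_restrict restrict_ext)
    have "(\<Sum>k\<in>K. r (f k)) < (\<Sum>k\<in>K. r (t k))"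
    proof (rule sum_strict_mono_ex1[OF assms(1)])
      show "\<forall>k\<in>K. r (f k) \<le> r (t k)"
        using f t by (metis PiE_mem less_imp_le order_refl)
      show "\<exists>k\<in>K. r (f k) < r (t k)"
        using k f t by (metis PiE_mem)
    qed
    moreover have "(\<Sum>k\<in>K. r (f k)) = (\<Sum>k\<in>K. r (t k))"
      using sum_rank_of_exponent[OF assms(1), of f r] sum_rank_of_exponent[OF assms(1), of t r] eq
      by simp
    ultimately show False
      by simp
  qed
  have "(\<Sum>k\<in>K. Poly_Mapping.single (?t k) (1::nat)) = (\<Sum>k\<in>K. Poly_Mapping.single (t k) 1)"
    by (intro sum.cong) auto
  moreover have "?t \<in> PiE K g" "finite (PiE K g)"
    using t(1) assms(1,2) by (auto intro: finite_PiE)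
  ultimately have "(\<Sum>f\<in>PiE K g. (\<Prod>k\<in>K. c k (f k)) when
        (\<Sum>k\<in>K. Poly_Mapping.single (f k) (1::nat)) = (\<Sum>k\<in>K. Poly_Mapping.single (t k) 1))
      = (\<Sum>f\<in>{?t}. \<Prod>k\<in>K. c k (f k))"
    by (intro sum.mono_neutral_cong_right) (auto simp: when_def dest: unique)
  then show ?thesis
    using assms(1,2) by (simp add: lookup_prod_linear_forms cong: prod.cong)
qed

section \<open>Multilinear expansion of differences\<close>

text \<open>If a difference has a nonzero coefficient, so has one of its two terms; this decides one
  factor at a time. The prefix \<open>q\<close> collects the factors already decided, and
  \<open>S\<close> records where \<open>A\<close> was taken.\<close>

lemma lookup_prod_diff_nonzero:
  fixes A B :: "'i \<Rightarrow> 'a::comm_ring_1 mpoly"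
  assumes "finite K" "Poly_Mapping.lookup (q * (\<Prod>k\<in>K. A k - B k)) \<alpha> \<noteq> 0"
  shows "\<exists>S. Poly_Mapping.lookup (q * (\<Prod>k\<in>K. if k \<in> S then A k else B k)) \<alpha> \<noteq> 0"
  using assms
proof (induction K arbitrary: q rule: finite_induct)
  case empty
  then show ?case
    by simp
next
  case (insert k K)
  let ?P = "\<Prod>k\<in>K. A k - B k"
  have "q * (\<Prod>k\<in>insert k K. A k - B k) = (q * A k) * ?P - (q * B k) * ?P"
    using insert.hyps by (simp add: algebra_simps)
  then have "Poly_Mapping.lookup ((q * A k) * ?P) \<alpha> \<noteq> 0 \<or> Poly_Mapping.lookup ((q * B k) * ?P) \<alpha> \<noteq> 0"
    using insert.prems by (auto simp: lookup_minus)
  then show ?case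
  proof
    assume "Poly_Mapping.lookup ((q * A k) * ?P) \<alpha> \<noteq> 0"
    from insert.IH[OF this] obtain S
      where S: "Poly_Mapping.lookup (q * A k * (\<Prod>l\<in>K. if l \<in> S then A l else B l)) \<alpha> \<noteq> 0"
      by blast
    \<comment> \<open>The set \<open>S\<close> from the induction says nothing reliable about
      \<open>k\<close>. As \<open>k\<close> is not in \<open>K\<close>, its membership can be reset
      without affecting the other factors.\<close>
    have "(\<Prod>l\<in>K. if l \<in> insert k S then A l else B l) = (\<Prod>l\<in>K. if l \<in> S then A l else B l)"
      using insert.hyps by (intro prod.cong) auto
    then show ?thesis
      using S insert.hyps by (intro exI[of _ "insert k S"]) (simp add: mult.assoc)
  next
    assume "Poly_Mapping.lookup ((q * B k) * ?P) \<alpha> \<noteq> 0"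
    from insert.IH[OF this] obtain S
      where S: "Poly_Mapping.lookup (q * B k * (\<Prod>l\<in>K. if l \<in> S then A l else B l)) \<alpha> \<noteq> 0"
      by blast
    have "(\<Prod>l\<in>K. if l \<in> S - {k} then A l else B l) = (\<Prod>l\<in>K. if l \<in> S then A l else B l)"
      using insert.hyps by (intro prod.cong) auto
    then show ?thesis
      using S insert.hyps by (intro exI[of _ "S - {k}"]) (simp add: mult.assoc)
  qed
qed

section \<open>Hypergraph polynomials\<close>

text \<open>The density ranges over nonempty subsets of \<open>{1..n}\<close>, whereas the sparsity
  lemmas ask for all finite sets. Passing to \<open>X \<inter> {1..n}\<close> loses no edge, and if
  this is empty no edge fits, since edges are nonempty.\<close>

lemma edge_density_bound:
  assumes "hypergraph n m e" "finite X"
  shows "card {k\<in>{1..m}. e k \<subseteq> X} \<le> nat \<lceil>edge_density n m e\<rceil> * card X"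
proof (cases "X \<inter> {1..n} = {}")
  case True
  have "\<not> e k \<subseteq> X" if "k \<in> {1..m}" for k
  proof
    assume "e k \<subseteq> X"
    with True assms(1) that have "e k = {}" "2 \<le> card (e k)"
      unfolding hypergraph_def by blast+
    then show False
      by simp
  qed
  then have "{k\<in>{1..m}. e k \<subseteq> X} = {}"
    by blast
  then show ?thesis
    by (simp only: card.empty le0)
next
  case False
  let ?Y = "X \<inter> {1..n}" and ?D = "edge_density n m e"
  have pos: "0 < card ?Y"
    using False by (simp add: card_gt_0_iff)
  have "real (card {k\<in>{1..m}. e k \<subseteq> ?Y}) / real (card ?Y) \<le> ?D"
    unfolding edge_density_def using False by (intro Max_ge imageI CollectI) auto
  also have "\<dots> \<le> real (nat \<lceil>?D\<rceil>)"
    by (rule real_nat_ceiling_ge)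
  finally have "real (card {k\<in>{1..m}. e k \<subseteq> ?Y}) \<le> real (nat \<lceil>?D\<rceil> * card ?Y)"
    using pos by (simp add: field_simps)
  then have "card {k\<in>{1..m}. e k \<subseteq> ?Y} \<le> nat \<lceil>?D\<rceil> * card ?Y"
    by (simp only: of_nat_le_iff)
  moreover have "{k\<in>{1..m}. e k \<subseteq> X} = {k\<in>{1..m}. e k \<subseteq> ?Y}"
    using assms(1) by (auto simp: hypergraph_def)
  moreover have "card ?Y \<le> card X"
    using assms(2) by (intro card_mono) auto
  ultimately show ?thesis
    by (metis (no_types, lifting) le_trans mult_le_mono2)
qed

text \<open>Ensures that \<open>nat\<close> does not alter the rounded density. The singleton
  \<open>{1}\<close> is an admissible set because \<open>1 \<le> n\<close>.\<close>

lemma edge_density_nonneg: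
  assumes "1 \<le> n"
  shows "0 \<le> edge_density n m e"
proof -
  have "0 \<le> real (card {k\<in>{1..m}. e k \<subseteq> {1}}) / real (card {1::nat})"
    by simp
  also have "\<dots> \<le> edge_density n m e"
    unfolding edge_density_def using assms
    by (intro Max_ge) (auto intro!: image_eqI[of _ _ "{1::nat}"])
  finally show ?thesis .
qed

text \<open>The product is homogeneous of degree \<open>m\<close>, so every monomial that occurs is
  a leading one and any single one bounds the minimum.\<close>

lemma alon_tarsi_number_hypergraph_polynomial_le:
  fixes c :: "nat \<Rightarrow> nat \<Rightarrow> 'a::comm_ring_1"
  assumes "1 \<le> n" "\<And>k. k \<in> {1..m} \<Longrightarrow> finite (e k)"
    and nz: "Poly_Mapping.lookup (hypergraph_polynomial m e c) \<alpha> \<noteq> 0"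
    and bound: "\<And>v. Poly_Mapping.lookup \<alpha> v \<le> b"
  shows "alon_tarsi_number n (hypergraph_polynomial m e c) \<le> b + 1"
proof -
  let ?p = "hypergraph_polynomial m e c"
  have homogeneous: "exponent_sum \<beta> = m" if "\<beta> \<in> Poly_Mapping.keys ?p" for \<beta>
  proof (rule ccontr)
    assume "exponent_sum \<beta> \<noteq> m"
    then have "(\<Sum>k\<in>{1..m}. Poly_Mapping.single (f k) 1) \<noteq> \<beta>" for f
      using exponent_sum_sum_single_one[of "{1..m}" f] by auto
    then have "Poly_Mapping.lookup ?p \<beta> = 0"
      unfolding hypergraph_polynomial_def using assms(2)
      by (subst lookup_prod_linear_forms) auto
    then show False
      using that by (simp add: in_keys_iff)
  qed
  have \<alpha>: "\<alpha> \<in> Poly_Mapping.keys ?p"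
    using nz by (simp add: in_keys_iff)
  then have "exponent_sum ` Poly_Mapping.keys ?p = {m}"
    using homogeneous by force
  then have "total_degree ?p = m"
    by (simp add: total_degree_def)
  then have lead: "\<alpha> \<in> leading_exponents ?p"
    using homogeneous[OF \<alpha>] nz by (simp add: leading_exponents_def)
  have "leading_exponents ?p \<subseteq> Poly_Mapping.keys ?p"
    by (auto simp: leading_exponents_def in_keys_iff)
  then have "finite (leading_exponents ?p)"
    by (rule finite_subset) simp
  then have "Min ((\<lambda>\<alpha>. Max (Poly_Mapping.lookup \<alpha> ` {1..n})) ` leading_exponents ?p)
      \<le> Max (Poly_Mapping.lookup \<alpha> ` {1..n})"
    using lead by (intro Min_le) auto
  also have "\<dots> \<le> b"
    using assms(1) bound by (subst Max_le_iff) auto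
  finally show ?thesis
    by (simp add: alon_tarsi_number_def)
qed

section \<open>Differences of permuted linear forms\<close>

text \<open>One transposition brings \<open>u\<close> to \<open>i\<close>; a second brings the image
  of \<open>v\<close> to \<open>j\<close> and fixes \<open>i\<close>, which differs from
  both.\<close>

lemma ex_permutes_two_points:
  assumes "u \<in> S" "v \<in> S" "u \<noteq> v" "i \<in> S" "j \<in> S" "i \<noteq> j"
  shows "\<exists>\<sigma>. \<sigma> permutes S \<and> \<sigma> u = i \<and> \<sigma> v = j"
proof -
  define \<rho> where "\<rho> = transpose u i"
  define \<sigma> where "\<sigma> = transpose (\<rho> v) j \<circ> \<rho>"
  have \<rho>: "\<rho> permutes S"
    unfolding \<rho>_def using assms by (intro permutes_swap_id)
  have "\<sigma> permutes S"
    unfolding \<sigma>_def using assms \<rho>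
    by (intro permutes_compose permutes_swap_id) (auto simp: permutes_in_image)
  moreover have "\<rho> u = i" "\<rho> v \<noteq> i"
    using assms by (auto simp: \<rho>_def transpose_def)
  then have "\<sigma> u = i" "\<sigma> v = j"
    using assms by (auto simp: \<sigma>_def)
  ultimately show ?thesis
    by (intro exI[of _ \<sigma>]) simp
qed

text \<open>Let \<sigma> place the unequal coefficients \<open>a i\<close> and \<open>a j\<close> on
  the two vertices of \<open>h\<close>, and let \<tau> be \<sigma> with these two swapped. All other
  terms cancel, which leaves coefficients \<plusminus>\<open>(a i - a j)\<close> on
  \<open>h\<close>.\<close>

lemma permuted_form_difference:
  fixes a :: "nat \<Rightarrow> 'a::comm_ring_1"
  assumes "finite S" "h \<subseteq> S" "card h = 2" "i \<in> S" "j \<in> S" "a i \<noteq> a j"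
  shows "\<exists>\<sigma> \<tau> c. \<sigma> permutes S \<and> \<tau> permutes S \<and> (\<forall>w\<in>h. c w \<noteq> 0) \<and>
           (\<Sum>w\<in>S. linear_term (a (\<sigma> w)) w) - (\<Sum>w\<in>S. linear_term (a (\<tau> w)) w)
           = (\<Sum>w\<in>h. linear_term (c w) w)"
proof -
  obtain u v where h: "h = {u, v}" "u \<noteq> v"
    using assms(3) by (auto simp: card_2_iff)
  then have uv: "u \<in> S" "v \<in> S"
    using assms(2) by auto
  obtain \<sigma> where \<sigma>: "\<sigma> permutes S" "\<sigma> u = i" "\<sigma> v = j"
    using ex_permutes_two_points[OF uv h(2) assms(4,5)] assms(6) by auto
  let ?\<tau> = "\<sigma> \<circ> transpose u v"
  let ?c = "\<lambda>w. a (\<sigma> w) - a (?\<tau> w)"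
  have "(\<Sum>w\<in>S. linear_term (a (\<sigma> w)) w) - (\<Sum>w\<in>S. linear_term (a (?\<tau> w)) w)
      = (\<Sum>w\<in>S. linear_term (?c w) w)"
    by (simp add: linear_term_diff sum_subtractf)
  also have "\<dots> = (\<Sum>w\<in>h. linear_term (?c w) w)"
    using assms(1,2) h by (intro sum.mono_neutral_right) (auto simp: linear_term_def transpose_def)
  finally have diff: "(\<Sum>w\<in>S. linear_term (a (\<sigma> w)) w) - (\<Sum>w\<in>S. linear_term (a (?\<tau> w)) w)
      = (\<Sum>w\<in>h. linear_term (?c w) w)" .
  show ?thesis
  proof (intro exI conjI)
    show "\<sigma> permutes S"
      by (rule \<sigma>(1))
    show "?\<tau> permutes S"
      using \<sigma>(1) uv by (intro permutes_compose permutes_swap_id)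
    show "\<forall>w\<in>h. ?c w \<noteq> 0"
      using h \<sigma> assms(6) by auto
  qed (rule diff)
qed

theorem theorem1p1:
  fixes n m :: nat
    and e :: "nat \<Rightarrow> nat set"
    and a :: "nat \<Rightarrow> nat \<Rightarrow> 'a::field"
  assumes "1 \<le> n"
    and "hypergraph n m e"
    and "\<forall>k\<in>{1..m}. \<forall>i\<in>e k. a k i \<noteq> 0"
    and "fully_unbalanced m e a"
  shows "\<exists>\<sigma> :: nat \<Rightarrow> nat \<Rightarrow> nat. (\<forall>k\<in>{1..m}. \<sigma> k permutes e k) \<and>
           int (alon_tarsi_number n (permuted_polynomial m e a \<sigma>))
             \<le> 2 * \<lceil>edge_density n m e\<rceil> + 1"
proof -
  define d where "d = nat \<lceil>edge_density n m e\<rceil>"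
  have d: "int d = \<lceil>edge_density n m e\<rceil>"
    using edge_density_nonneg[OF assms(1), of m e] by (simp add: d_def)
  have e: "e k \<subseteq> {1..n}" "finite (e k)" "2 \<le> card (e k)" if "k \<in> {1..m}" for k
    using assms(2) that finite_subset[of "e k" "{1..n}"] unfolding hypergraph_def by blast+
  have "\<exists>h. (\<forall>k\<in>{1..m}. h k \<subseteq> e k \<and> card (h k) = 2) \<and>
      (\<forall>X. finite X \<longrightarrow> card {l\<in>{1..m}. h l \<subseteq> X} \<le> d * card X)"
    unfolding d_def using e(2,3) edge_density_bound[OF assms(2)]
    by (intro sparse_shrink_to_pairs) auto
  then obtain h where h: "\<And>k. k \<in> {1..m} \<Longrightarrow> h k \<subseteq> e k" "\<And>k. k \<in> {1..m} \<Longrightarrow> card (h k) = 2"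
    and sparse: "\<And>X. finite X \<Longrightarrow> card {l\<in>{1..m}. h l \<subseteq> X} \<le> d * card X"
    by metis
  have fin: "finite (h k)" "h k \<noteq> {}" if "k \<in> {1..m}" for k
    using h(2)[OF that] by (auto intro: card_ge_0_finite)
  obtain r :: "nat \<Rightarrow> nat" where r: "inj_on r {1..n}" "\<And>v. v \<in> {1..n} \<Longrightarrow>
      card {k\<in>{1..m}. v \<in> h k \<and> h k \<subseteq> {1..n} \<and> (\<forall>w\<in>h k. r w \<le> r v)} \<le> 2 * d"
    using sparse_degenerate_ranking[OF _ h(2) sparse, of "{1..n}"] by auto
  have "\<exists>v\<in>h k. \<forall>w\<in>h k. r w \<le> r v" if "k \<in> {1..m}" for k
  proof -
    have "Max (r ` h k) \<in> r ` h k"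
      using fin[OF that] by (intro Max_in) auto
    then obtain v where "v \<in> h k" "r v = Max (r ` h k)"
      by auto
    then show ?thesis
      using fin(1)[OF that] by (intro bexI[of _ v]) auto
  qed
  then obtain t where t: "\<And>k. k \<in> {1..m} \<Longrightarrow> t k \<in> h k"
    "\<And>k w. k \<in> {1..m} \<Longrightarrow> w \<in> h k \<Longrightarrow> r w \<le> r (t k)"
    by metis
  have h_sub: "h k \<subseteq> {1..n}" if "k \<in> {1..m}" for k
    using h(1) e(1) that by blast
  \<comment> \<open>Injectivity of \<open>r\<close> on the vertex set rules out ties for the
    top.\<close>
  have t_strict: "r v < r (t k)" if "k \<in> {1..m}" "v \<in> h k" "v \<noteq> t k" for k v
    using that t h_sub r(1) by (metis inj_on_contraD le_neq_implies_less subsetD)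
  \<comment> \<open>The exponent of \<open>v\<close> is the number of pairs with top
    \<open>v\<close>, which the ranking bounds by \<open>2 * d\<close>.\<close>
  define \<alpha> where "\<alpha> = (\<Sum>k\<in>{1..m}. Poly_Mapping.single (t k) (1::nat))"
  have bound: "Poly_Mapping.lookup \<alpha> v \<le> 2 * d" for v
  proof (cases "v \<in> {1..n}")
    case True
    have "card {k\<in>{1..m}. t k = v}
        \<le> card {k\<in>{1..m}. v \<in> h k \<and> h k \<subseteq> {1..n} \<and> (\<forall>w\<in>h k. r w \<le> r v)}"
    proof (intro card_mono subsetI)
      fix k assume "k \<in> {k\<in>{1..m}. t k = v}"
      then have "k \<in> {1..m}" "v = t k"
        by auto
      then show "k \<in> {k\<in>{1..m}. v \<in> h k \<and> h k \<subseteq> {1..n} \<and> (\<forall>w\<in>h k. r w \<le> r v)}"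
        using t[of k] h_sub[of k] by blast
    qed simp
    then show ?thesis
      using r(2)[OF True] by (simp only: \<alpha>_def lookup_sum_single_one finite_atLeastAtMost)
  next
    case False
    then have "{k\<in>{1..m}. t k = v} = {}"
      using t(1) h_sub by blast
    then show ?thesis
      by (simp only: \<alpha>_def lookup_sum_single_one finite_atLeastAtMost card.empty)
  qed
  have "\<forall>k\<in>{1..m}. \<exists>\<sigma> \<tau> c. \<sigma> permutes e k \<and> \<tau> permutes e k \<and> (\<forall>w\<in>h k. c w \<noteq> 0) \<and>
      (\<Sum>w\<in>e k. linear_term (a k (\<sigma> w)) w) - (\<Sum>w\<in>e k. linear_term (a k (\<tau> w)) w)
      = (\<Sum>w\<in>h k. linear_term (c w) w)" (is "\<forall>k\<in>_. ?swappable k")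
  proof
    fix k assume k: "k \<in> {1..m}"
    obtain i j where "i \<in> e k" "j \<in> e k" "a k i \<noteq> a k j"
      using assms(4) k unfolding fully_unbalanced_def by blast
    then show "?swappable k"
      by (rule permuted_form_difference[OF e(2)[OF k] h[OF k], where a = "a k"])
  qed
  then obtain \<sigma> \<tau> c where swap: "\<forall>k\<in>{1..m}. \<sigma> k permutes e k \<and> \<tau> k permutes e k \<and>
      (\<forall>w\<in>h k. c k w \<noteq> 0) \<and>
      (\<Sum>w\<in>e k. linear_term (a k (\<sigma> k w)) w) - (\<Sum>w\<in>e k. linear_term (a k (\<tau> k w)) w)
      = (\<Sum>w\<in>h k. linear_term (c k w) w)"
    unfolding bchoice_iff by (elim exE)
  let ?L = "\<lambda>\<sigma> k. \<Sum>w\<in>e k. linear_term (a k (\<sigma> k w)) w"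
  have "Poly_Mapping.lookup (\<Prod>k\<in>{1..m}. \<Sum>w\<in>h k. linear_term (c k w) w) \<alpha> = (\<Prod>k\<in>{1..m}. c k (t k))"
    unfolding \<alpha>_def using finite_atLeastAtMost fin(1) t(1) t_strict
    by (rule lookup_prod_linear_forms_top)
  \<comment> \<open>A product of nonzero elements of a field.\<close>
  also have "\<dots> \<noteq> 0"
    using swap t(1) by simp
  \<comment> \<open>The factor 1 is the empty prefix from which the multilinear expansion
    starts.\<close>
  also have "(\<Prod>k\<in>{1..m}. \<Sum>w\<in>h k. linear_term (c k w) w) = 1 * (\<Prod>k\<in>{1..m}. ?L \<sigma> k - ?L \<tau> k)"
    using swap by simp
  finally obtain S where
    S: "Poly_Mapping.lookup (1 * (\<Prod>k\<in>{1..m}. if k \<in> S then ?L \<sigma> k else ?L \<tau> k)) \<alpha> \<noteq> 0"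
    using lookup_prod_diff_nonzero[of "{1..m}" 1 "?L \<sigma>" "?L \<tau>" \<alpha>] by blast
  \<comment> \<open>The expansion selects for each edge one of its two permutations, so the selected
    product is itself a permuted polynomial.\<close>
  let ?\<rho> = "\<lambda>k. if k \<in> S then \<sigma> k else \<tau> k"
  have "(\<Prod>k\<in>{1..m}. if k \<in> S then ?L \<sigma> k else ?L \<tau> k) = permuted_polynomial m e a ?\<rho>"
    unfolding permuted_polynomial_def hypergraph_polynomial_def by (intro prod.cong) auto
  then have "Poly_Mapping.lookup (permuted_polynomial m e a ?\<rho>) \<alpha> \<noteq> 0"
    using S by simp
  then have "alon_tarsi_number n (permuted_polynomial m e a ?\<rho>) \<le> 2 * d + 1"
    unfolding permuted_polynomial_def
    using e(2) bound by (intro alon_tarsi_number_hypergraph_polynomial_le[OF assms(1)])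
  then have "int (alon_tarsi_number n (permuted_polynomial m e a ?\<rho>))
      \<le> 2 * \<lceil>edge_density n m e\<rceil> + 1"
    by (simp flip: d)
  then show ?thesis
    using swap by (intro exI[of _ ?\<rho>]) auto
qed

end
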